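(* Let $\Sigma=(X,X_0,S,U,\to,Y,h)$ be an NTS and let $\sim\subseteq X\times X$ be an equivalence relation on $X$ such that $h(x)=h(x')$ for all $(x,x')\in\sim$. Assume that for all $x\in S$ and $x'\in X$, if $(x,x')\in\sim$ then $x'\in S$. Then the quotient relation $\sim_{\mathsf{Q}}=\{(x,[x])\mid x\in X\}\subseteq X\times X_\sim$ is an InfSOP bisimulation relation between $\Sigma$ and its quotient system $\Sigma_\sim$ if and only if $\sim$ is an InfSOP bisimulation relation between $\Sigma$ and itself.
   Context: A nondeterministic transition system (NTS) is a tuple $\Sigma=(X,X_0,S,U,\to,Y,h)$, where $X$ is a (possibly infinite) set of states, $X_0\subseteq X$ the initial states, $S\subseteq X$ the secret states, $U$ a (possibly infinite) set of inputs, $\to\subseteq X\times U\times X$ the transition relation (write $x\xrightarrow{u}x'$ for $(x,u,x')\in\to$), $Y$ a set of outputs and $h:X\to Y$ the output map. For an equivalence relation $\sim$ on $X$ with $h(x)=h(x')$ whenever $(x,x')\in\sim$, let $[x]=\{x'\in X\mid (x',x)\in\sim\}$. The quotient system is $\Sigma_\sim=(X_\sim,X_{\sim,0},S_\sim,U,\to_\sim,Y,h_\sim)$ with $X_\sim=\{[x]\mid x\in X\}$, $X_{\sim,0}=\{[x]\mid [x]\cap X_0\neq\emptyset\}$, $S_\sim=\{[x]\mid [x]\cap S\neq\emptyset\}$, $[x]\xrightarrow{u}_\sim[x']$ iff there exist $\bar x\in[x]$, $\bar x'\in[x']$ with $\bar x\xrightarrow{u}\bar x'$, and $h_\sim([x])=h(\bar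 x)$ for any $\bar x\in[x]$. For NTSs $\Sigma_1=(X_1,X_{1,0},S_1,U,\to_1,Y,h_1)$, $\Sigma_2=(X_2,X_{2,0},S_2,U,\to_2,Y,h_2)$, a relation $R\subseteq X_1\times X_2$ is an InfSOP bisimulation relation between $\Sigma_1$ and $\Sigma_2$ if: (1a) for every $x_{1,0}\in X_{1,0}\cap S_1$ there is $x_{2,0}\in X_{2,0}\cap S_2$ with $(x_{1,0},x_{2,0})\in R$; (1b) for every $x_{1,0}\in X_{1,0}\setminus S_1$ there is $x_{2,0}\in X_{2,0}\setminus S_2$ with $(x_{1,0},x_{2,0})\in R$; (1c) for every $x_{2,0}\in X_{2,0}\cap S_2$ there is $x_{1,0}\in X_{1,0}\cap S_1$ with $(x_{1,0},x_{2,0})\in R$; (1d) for every $x_{2,0}\in X_{2,0}\setminus S_2$ there is $x_{1,0}\in X_{1,0}\setminus S_1$ with $(x_{1,0},x_{2,0})\in R$; (2) $h_1(x_1)=h_2(x_2)$ for all $(x_1,x_2)\in R$; (3) for every $(x_1,x_2)\in R$ and every $u\in U$: (a) for every $x_1\xrightarrow{u}_1x_1'$ with $x_1'\in S_1$ there is $x_2\xrightarrow{u}_2x_2'$ with $x_2'\in S_2$ and $(x_1',x_2')\in R$; (b) for every $x_1\xrightarrow{u}_1x_1'$ with $x_1'\in X_1\setminus S_1$ there is $x_2\xrightarrow{u}_2x_2'$ with $x_2'\in X_2\setminus S_2$ and $(x_1',x_2')\in R$; (c) for every $x_2\xrightarrow{u}_2x_2'$ with $x_2'\in S_2$ there is $x_1\xrightarrow{u}_1x_1'$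 with $x_1'\in S_1$ and $(x_1',x_2')\in R$; (d) for every $x_2\xrightarrow{u}_2x_2'$ with $x_2'\in X_2\setminus S_2$ there is $x_1\xrightarrow{u}_1x_1'$ with $x_1'\in X_1\setminus S_1$ and $(x_1',x_2')\in R$. *)

theory Defs
  imports Main
begin

record ('x, 'u, 'y) nts =
  states :: "'x set"
  init :: "'x set"
  secret :: "'x set"
  inputs :: "'u set"
  transitions :: "('x \<times> 'u \<times> 'x) set"
  outputs :: "'y set"
  out_map :: "'x \<Rightarrow> 'y"

definition is_nts :: "('x, 'u, 'y) nts \<Rightarrow> bool" where
  "is_nts \<Sigma> \<longleftrightarrow>
     init \<Sigma> \<subseteq> states \<Sigma> \<and>
     secret \<Sigma> \<subseteq> states \<Sigma> \<and>
     transitions \<Sigma> \<subseteq> states \<Sigma> \<times> inputs \<Sigma> \<times> states \<Sigma> \<and>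
     out_map \<Sigma> ` states \<Sigma> \<subseteq> outputs \<Sigma>"

definition eq_class :: "'x set \<Rightarrow> ('x \<times> 'x) set \<Rightarrow> 'x \<Rightarrow> 'x set" where
  "eq_class X r x = {x' \<in> X. (x', x) \<in> r}"

text \<open>The output of a class is that of an arbitrarily chosen representative; this is independent
  of the choice when \<open>r\<close> is an equivalence relation on the states that respects the output map.\<close>

definition quotient_nts :: "('x, 'u, 'y) nts \<Rightarrow> ('x \<times> 'x) set \<Rightarrow> ('x set, 'u, 'y) nts" where
  "quotient_nts \<Sigma> r = (let X = states \<Sigma>; cls = eq_class X r in
     \<lparr> states = {cls x | x. x \<in> X},
       init = {cls x | x. x \<in> X \<and> cls x \<inter> init \<Sigma> \<noteq> {}},
       secret = {cls x | x. x \<in> X \<and> cls x \<inter> secret \<Sigma> \<noteq> {}},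
       inputs = inputs \<Sigma>,
       transitions = {(cls x, u, cls x') | x u x'. x \<in> X \<and> x' \<in> X \<and>
         (\<exists>z \<in> cls x. \<exists>z' \<in> cls x'. (z, u, z') \<in> transitions \<Sigma>)},
       outputs = outputs \<Sigma>,
       out_map = (\<lambda>c. out_map \<Sigma> (SOME z. z \<in> c)) \<rparr>)"

definition quotient_rel :: "('x, 'u, 'y) nts \<Rightarrow> ('x \<times> 'x) set \<Rightarrow> ('x \<times> 'x set) set" where
  "quotient_rel \<Sigma> r = {(x, eq_class (states \<Sigma>) r x) | x. x \<in> states \<Sigma>}"

definition infsop_bisimulation ::
  "('x1, 'u, 'y) nts \<Rightarrow> ('x2, 'u, 'y) nts \<Rightarrow> ('x1 \<times> 'x2) set \<Rightarrow> bool" where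
  "infsop_bisimulation \<Sigma>1 \<Sigma>2 R \<longleftrightarrow>
     inputs \<Sigma>1 = inputs \<Sigma>2 \<and> outputs \<Sigma>1 = outputs \<Sigma>2 \<and>
     R \<subseteq> states \<Sigma>1 \<times> states \<Sigma>2 \<and>
     (\<forall>x1 \<in> init \<Sigma>1 \<inter> secret \<Sigma>1. \<exists>x2 \<in> init \<Sigma>2 \<inter> secret \<Sigma>2. (x1, x2) \<in> R) \<and>
     (\<forall>x1 \<in> init \<Sigma>1 - secret \<Sigma>1. \<exists>x2 \<in> init \<Sigma>2 - secret \<Sigma>2. (x1, x2) \<in> R) \<and>
     (\<forall>x2 \<in> init \<Sigma>2 \<inter> secret \<Sigma>2. \<exists>x1 \<in> init \<Sigma>1 \<inter> secret \<Sigma>1. (x1, x2) \<in> R) \<and>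
     (\<forall>x2 \<in> init \<Sigma>2 - secret \<Sigma>2. \<exists>x1 \<in> init \<Sigma>1 - secret \<Sigma>1. (x1, x2) \<in> R) \<and>
     (\<forall>(x1, x2) \<in> R. out_map \<Sigma>1 x1 = out_map \<Sigma>2 x2) \<and>
     (\<forall>(x1, x2) \<in> R. \<forall>u \<in> inputs \<Sigma>1.
       (\<forall>x1' \<in> secret \<Sigma>1. (x1, u, x1') \<in> transitions \<Sigma>1 \<longrightarrow>
          (\<exists>x2' \<in> secret \<Sigma>2. (x2, u, x2') \<in> transitions \<Sigma>2 \<and> (x1', x2') \<in> R)) \<and>
       (\<forall>x1' \<in> states \<Sigma>1 - secret \<Sigma>1. (x1, u, x1') \<in> transitions \<Sigma>1 \<longrightarrow>
          (\<exists>x2' \<in> states \<Sigma>2 - secret \<Sigma>2. (x2, u, x2') \<in> transitions \<Sigma>2 \<and> (x1', x2') \<in> R)) \<and>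
       (\<forall>x2' \<in> secret \<Sigma>2. (x2, u, x2') \<in> transitions \<Sigma>2 \<longrightarrow>
          (\<exists>x1' \<in> secret \<Sigma>1. (x1, u, x1') \<in> transitions \<Sigma>1 \<and> (x1', x2') \<in> R)) \<and>
       (\<forall>x2' \<in> states \<Sigma>2 - secret \<Sigma>2. (x2, u, x2') \<in> transitions \<Sigma>2 \<longrightarrow>
          (\<exists>x1' \<in> states \<Sigma>1 - secret \<Sigma>1. (x1, u, x1') \<in> transitions \<Sigma>1 \<and> (x1', x2') \<in> R)))"

lemma eq_class_self:
  assumes "equiv X r" and "x \<in> X"
  shows "x \<in> eq_class X r x"
  using assms by (auto simp: eq_class_def equiv_def refl_on_def)

lemma output_quotient_nts:
  assumes "equiv (states \<Sigma>) r"
    and "\<forall>(x, x') \<in> r. out_map \<Sigma> x = out_map \<Sigma> x'"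
    and "z \<in> eq_class (states \<Sigma>) r x"
  shows "out_map (quotient_nts \<Sigma> r) (eq_class (states \<Sigma>) r x) = out_map \<Sigma> z"
proof -
  have "(SOME z. z \<in> eq_class (states \<Sigma>) r x) \<in> eq_class (states \<Sigma>) r x"
    using assms(3) by (rule someI)
  then have "out_map \<Sigma> (SOME z. z \<in> eq_class (states \<Sigma>) r x) = out_map \<Sigma> x"
    and "out_map \<Sigma> z = out_map \<Sigma> x"
    using assms(2,3) by (auto simp: eq_class_def)
  then show ?thesis by (simp add: quotient_nts_def Let_def)
qed

lemma is_nts_quotient_nts:
  assumes "is_nts \<Sigma>" and "equiv (states \<Sigma>) r"
    and "\<forall>(x, x') \<in> r. out_map \<Sigma> x = out_map \<Sigma> x'"
  shows "is_nts (quotient_nts \<Sigma> r)"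
proof -
  have "out_map (quotient_nts \<Sigma> r) (eq_class (states \<Sigma>) r x) \<in> outputs \<Sigma>"
    if "x \<in> states \<Sigma>" for x
    using output_quotient_nts[OF assms(2,3) eq_class_self[OF assms(2) that]] assms(1) that
    by (auto simp: is_nts_def)
  then show ?thesis
    using assms(1) unfolding is_nts_def quotient_nts_def Let_def by auto
qed

end

theory Submission
  imports Defs
begin

text \<open>When the secret set is a union of classes, the secrecy and initial-state clauses hold
  automatically, for the relation as well as for its quotient relation. Both notions then reduce
  to the same zigzag property: related states can match each other's transitions up to the
  relation.\<close>

definition transition_matching :: "('x, 'u, 'y) nts \<Rightarrow> ('x \<times> 'x) set \<Rightarrow> bool" where
  "transition_matching \<Sigma> r \<longleftrightarrow>
     (\<forall>x y u x'. (x, y) \<in> r \<longrightarrow> (x, u, x') \<in> transitions \<Sigma> \<longrightarrow>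
        (\<exists>y'. (y, u, y') \<in> transitions \<Sigma> \<and> (x', y') \<in> r))"

text \<open>Each secret/nonsecret pair of clauses merges into one: a match of the same secrecy
  status serves both cases. The target is also asked to be a state because the nonsecret clauses
  speak of \<open>states\<close> minus \<open>secret\<close>.\<close>

lemma infsop_bisimulationI:
  assumes "inputs \<Sigma>1 = inputs \<Sigma>2" and "outputs \<Sigma>1 = outputs \<Sigma>2"
    and "R \<subseteq> states \<Sigma>1 \<times> states \<Sigma>2"
    and init_forth: "\<And>x1. x1 \<in> init \<Sigma>1 \<Longrightarrow>
      \<exists>x2 \<in> init \<Sigma>2. (x1, x2) \<in> R \<and> (x1 \<in> secret \<Sigma>1 \<longleftrightarrow> x2 \<in> secret \<Sigma>2)"
    and init_back: "\<And>x2. x2 \<in> init \<Sigma>2 \<Longrightarrow>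
      \<exists>x1 \<in> init \<Sigma>1. (x1, x2) \<in> R \<and> (x1 \<in> secret \<Sigma>1 \<longleftrightarrow> x2 \<in> secret \<Sigma>2)"
    and out: "\<And>x1 x2. (x1, x2) \<in> R \<Longrightarrow> out_map \<Sigma>1 x1 = out_map \<Sigma>2 x2"
    and step_forth: "\<And>x1 x2 u x1'. (x1, x2) \<in> R \<Longrightarrow> (x1, u, x1') \<in> transitions \<Sigma>1 \<Longrightarrow>
      \<exists>x2' \<in> states \<Sigma>2. (x2, u, x2') \<in> transitions \<Sigma>2 \<and> (x1', x2') \<in> R \<and>
        (x1' \<in> secret \<Sigma>1 \<longleftrightarrow> x2' \<in> secret \<Sigma>2)"
    and step_back: "\<And>x1 x2 u x2'. (x1, x2) \<in> R \<Longrightarrow> (x2, u, x2') \<in> transitions \<Sigma>2 \<Longrightarrow>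
      \<exists>x1' \<in> states \<Sigma>1. (x1, u, x1') \<in> transitions \<Sigma>1 \<and> (x1', x2') \<in> R \<and>
        (x1' \<in> secret \<Sigma>1 \<longleftrightarrow> x2' \<in> secret \<Sigma>2)"
  shows "infsop_bisimulation \<Sigma>1 \<Sigma>2 R"
  unfolding infsop_bisimulation_def
proof (intro conjI; (intro subsetI | clarify)?)
  fix x1 x2 u
  assume R: "(x1, x2) \<in> R"
  show "(\<forall>x1' \<in> secret \<Sigma>1. (x1, u, x1') \<in> transitions \<Sigma>1 \<longrightarrow>
          (\<exists>x2' \<in> secret \<Sigma>2. (x2, u, x2') \<in> transitions \<Sigma>2 \<and> (x1', x2') \<in> R)) \<and>
       (\<forall>x1' \<in> states \<Sigma>1 - secret \<Sigma>1. (x1, u, x1') \<in> transitions \<Sigma>1 \<longrightarrow>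
          (\<exists>x2' \<in> states \<Sigma>2 - secret \<Sigma>2. (x2, u, x2') \<in> transitions \<Sigma>2 \<and> (x1', x2') \<in> R)) \<and>
       (\<forall>x2' \<in> secret \<Sigma>2. (x2, u, x2') \<in> transitions \<Sigma>2 \<longrightarrow>
          (\<exists>x1' \<in> secret \<Sigma>1. (x1, u, x1') \<in> transitions \<Sigma>1 \<and> (x1', x2') \<in> R)) \<and>
       (\<forall>x2' \<in> states \<Sigma>2 - secret \<Sigma>2. (x2, u, x2') \<in> transitions \<Sigma>2 \<longrightarrow>
          (\<exists>x1' \<in> states \<Sigma>1 - secret \<Sigma>1. (x1, u, x1') \<in> transitions \<Sigma>1 \<and> (x1', x2') \<in> R))"
    by (intro conjI ballI impI) ((drule step_forth[OF R] | drule step_back[OF R]), blast)+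
qed (rule assms(1,2) | erule subsetD[OF assms(3)] | erule out | drule init_forth, blast |
    drule init_back, blast)+

text \<open>Forgetting secrecy leaves plain matching in both directions: a target state is either
  secret or not, and one transition clause covers each case.\<close>

lemma infsop_bisimulation_transitions:
  assumes bisim: "infsop_bisimulation \<Sigma>1 \<Sigma>2 R" and R: "(x1, x2) \<in> R" and u: "u \<in> inputs \<Sigma>1"
  shows infsop_bisimulation_forth: "(x1, u, x1') \<in> transitions \<Sigma>1 \<Longrightarrow> x1' \<in> states \<Sigma>1 \<Longrightarrow>
      \<exists>x2'. (x2, u, x2') \<in> transitions \<Sigma>2 \<and> (x1', x2') \<in> R"
    and infsop_bisimulation_back: "(x2, u, x2') \<in> transitions \<Sigma>2 \<Longrightarrow> x2' \<in> states \<Sigma>2 \<Longrightarrow>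
      \<exists>x1'. (x1, u, x1') \<in> transitions \<Sigma>1 \<and> (x1', x2') \<in> R"
proof -
  \<comment> \<open>The eight projections pass over inputs, outputs, the carrier of
    \<open>R\<close>, the four initial clauses and the output clause, leaving the four transition
    clauses.\<close>
  note clauses = bisim[unfolded infsop_bisimulation_def, THEN conjunct2, THEN conjunct2,
      THEN conjunct2, THEN conjunct2, THEN conjunct2, THEN conjunct2, THEN conjunct2,
      THEN conjunct2, THEN bspec, OF R, unfolded case_prod_conv, THEN bspec, OF u]
  show "\<exists>x2'. (x2, u, x2') \<in> transitions \<Sigma>2 \<and> (x1', x2') \<in> R"
    if "(x1, u, x1') \<in> transitions \<Sigma>1" "x1' \<in> states \<Sigma>1"
    using clauses[THEN conjunct1] clauses[THEN conjunct2, THEN conjunct1] that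
    by (cases "x1' \<in> secret \<Sigma>1") blast+
  show "\<exists>x1'. (x1, u, x1') \<in> transitions \<Sigma>1 \<and> (x1', x2') \<in> R"
    if "(x2, u, x2') \<in> transitions \<Sigma>2" "x2' \<in> states \<Sigma>2"
    using clauses[THEN conjunct2, THEN conjunct2] that
    by (cases "x2' \<in> secret \<Sigma>2") blast+
qed

locale secret_saturated_equiv =
  fixes \<Sigma> :: "('x, 'u, 'y) nts" and r :: "('x \<times> 'x) set"
  assumes nts: "is_nts \<Sigma>"
    and equiv: "equiv (states \<Sigma>) r"
    and out_map_eq: "\<And>x y. (x, y) \<in> r \<Longrightarrow> out_map \<Sigma> x = out_map \<Sigma> y"
    and saturated: "\<And>x y. (x, y) \<in> r \<Longrightarrow> x \<in> secret \<Sigma> \<Longrightarrow> y \<in> secret \<Sigma>"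
begin

abbreviation cls :: "'x \<Rightarrow> 'x set" where
  "cls \<equiv> eq_class (states \<Sigma>) r"

abbreviation quot :: "('x set, 'u, 'y) nts" where
  "quot \<equiv> quotient_nts \<Sigma> r"

lemma rel_states: "(x, y) \<in> r \<Longrightarrow> x \<in> states \<Sigma> \<and> y \<in> states \<Sigma>"
  using equiv by (auto simp: equiv_def)

lemma rel_refl: "x \<in> states \<Sigma> \<Longrightarrow> (x, x) \<in> r"
  using equiv by (auto simp: equiv_def refl_on_def)

lemma rel_sym: "(x, y) \<in> r \<Longrightarrow> (y, x) \<in> r"
  using equiv by (auto simp: equiv_def dest: symD)

lemma rel_trans: "(x, y) \<in> r \<Longrightarrow> (y, z) \<in> r \<Longrightarrow> (x, z) \<in> r"
  using equiv by (auto simp: equiv_def dest: transD)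

lemma secret_iff: "(x, y) \<in> r \<Longrightarrow> x \<in> secret \<Sigma> \<longleftrightarrow> y \<in> secret \<Sigma>"
  using saturated rel_sym by blast

lemma init_states: "x \<in> init \<Sigma> \<Longrightarrow> x \<in> states \<Sigma>"
  using nts by (auto simp: is_nts_def)

lemma secret_states: "x \<in> secret \<Sigma> \<Longrightarrow> x \<in> states \<Sigma>"
  using nts by (auto simp: is_nts_def)

lemma transition_states:
  "(x, u, y) \<in> transitions \<Sigma> \<Longrightarrow> x \<in> states \<Sigma> \<and> u \<in> inputs \<Sigma> \<and> y \<in> states \<Sigma>"
  using nts by (auto simp: is_nts_def)

lemma in_cls_iff: "z \<in> cls x \<longleftrightarrow> (z, x) \<in> r"
  using rel_states by (auto simp: eq_class_def)

text \<open>Reflexivity at \<open>x\<close> puts \<open>x\<close> into its own class, hence into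
  \<open>cls y\<close> if the classes agree; the converse is symmetry and transitivity.\<close>

lemma cls_eq_iff: "x \<in> states \<Sigma> \<Longrightarrow> cls x = cls y \<longleftrightarrow> (x, y) \<in> r"
  unfolding set_eq_iff in_cls_iff using rel_refl rel_sym rel_trans by meson

lemma states_quot: "c \<in> states quot \<longleftrightarrow> (\<exists>x \<in> states \<Sigma>. c = cls x)"
  by (auto simp: quotient_nts_def Let_def)

text \<open>A class that meets \<open>init \<Sigma>\<close> is the class of the initial state it
  contains, so the representative itself can be chosen initial. The same change of representative
  gives \<open>secret_quot\<close>.\<close>

lemma init_quot: "c \<in> init quot \<longleftrightarrow> (\<exists>x \<in> init \<Sigma>. c = cls x)"
proof -
  have "c \<in> init quot \<longleftrightarrow> (\<exists>x \<in> states \<Sigma>. c = cls x \<and> (\<exists>z \<in> init \<Sigma>. (z, x) \<in> r))"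
    by (auto simp: quotient_nts_def Let_def in_cls_iff disjoint_iff)
  also have "\<dots> \<longleftrightarrow> (\<exists>x \<in> init \<Sigma>. c = cls x)"
    using cls_eq_iff init_states rel_refl by metis
  finally show ?thesis .
qed

lemma secret_quot: "c \<in> secret quot \<longleftrightarrow> (\<exists>x \<in> secret \<Sigma>. c = cls x)"
proof -
  have "c \<in> secret quot \<longleftrightarrow> (\<exists>x \<in> states \<Sigma>. c = cls x \<and> (\<exists>z \<in> secret \<Sigma>. (z, x) \<in> r))"
    by (auto simp: quotient_nts_def Let_def in_cls_iff disjoint_iff)
  also have "\<dots> \<longleftrightarrow> (\<exists>x \<in> secret \<Sigma>. c = cls x)"
    using cls_eq_iff secret_states rel_refl by metis
  finally show ?thesis .
qed

text \<open>Saturation enters here: a class that meets the secret set lies inside it, so every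
  representative decides the secrecy of its class.\<close>

lemma cls_in_secret_quot: "x \<in> states \<Sigma> \<Longrightarrow> cls x \<in> secret quot \<longleftrightarrow> x \<in> secret \<Sigma>"
  unfolding secret_quot using cls_eq_iff secret_iff by blast

text \<open>The endpoints of the underlying transition can replace the two chosen representatives,
  since they lie in the same classes.\<close>

lemma transitions_quot:
  "(c, u, d) \<in> transitions quot \<longleftrightarrow> (\<exists>z z'. c = cls z \<and> d = cls z' \<and> (z, u, z') \<in> transitions \<Sigma>)"
proof -
  have "(c, u, d) \<in> transitions quot \<longleftrightarrow>
      (\<exists>x \<in> states \<Sigma>. \<exists>x' \<in> states \<Sigma>. c = cls x \<and> d = cls x' \<and>
         (\<exists>z z'. (z, x) \<in> r \<and> (z', x') \<in> r \<and> (z, u, z') \<in> transitions \<Sigma>))"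
    by (auto simp: quotient_nts_def Let_def in_cls_iff Bex_def)
  also have "\<dots> \<longleftrightarrow> (\<exists>z z'. c = cls z \<and> d = cls z' \<and> (z, u, z') \<in> transitions \<Sigma>)"
  proof (intro iffI; elim bexE exE conjE)
    fix x x' z z'
    assume "c = cls x" "d = cls x'" "(z, x) \<in> r" "(z', x') \<in> r" "(z, u, z') \<in> transitions \<Sigma>"
    moreover from this have "cls z = cls x" "cls z' = cls x'"
      using rel_states by (simp_all add: cls_eq_iff)
    ultimately show "\<exists>z z'. c = cls z \<and> d = cls z' \<and> (z, u, z') \<in> transitions \<Sigma>"
      by metis
  next
    fix z z'
    assume "c = cls z" "d = cls z'" and step: "(z, u, z') \<in> transitions \<Sigma>"
    then show "\<exists>x \<in> states \<Sigma>. \<exists>x' \<in> states \<Sigma>. c = cls x \<and> d = cls x' \<and>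
        (\<exists>z z'. (z, x) \<in> r \<and> (z', x') \<in> r \<and> (z, u, z') \<in> transitions \<Sigma>)"
      using transition_states[OF step] rel_refl[of z] rel_refl[of z'] by blast
  qed
  finally show ?thesis .
qed

lemma out_map_quot: "x \<in> states \<Sigma> \<Longrightarrow> out_map quot (cls x) = out_map \<Sigma> x"
  using output_quotient_nts[OF equiv _ eq_class_self[OF equiv]] out_map_eq by auto

lemma inputs_quot: "inputs quot = inputs \<Sigma>"
  by (simp add: quotient_nts_def Let_def)

lemma outputs_quot: "outputs quot = outputs \<Sigma>"
  by (simp add: quotient_nts_def Let_def)

lemma quotient_rel_iff: "(x, c) \<in> quotient_rel \<Sigma> r \<longleftrightarrow> x \<in> states \<Sigma> \<and> c = cls x"
  by (auto simp: quotient_rel_def)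

text \<open>Related states agree on secrecy, so a match up to \<open>r\<close> has the right status,
  and initial states match themselves by reflexivity. Matching in one direction suffices because
  \<open>r\<close> is symmetric.\<close>

lemma infsop_self_iff: "infsop_bisimulation \<Sigma> \<Sigma> r \<longleftrightarrow> transition_matching \<Sigma> r"
proof
  assume "infsop_bisimulation \<Sigma> \<Sigma> r"
  from infsop_bisimulation_forth[OF this] show "transition_matching \<Sigma> r"
    unfolding transition_matching_def using transition_states by blast
next
  assume matching: "transition_matching \<Sigma> r"
  have forth: "\<exists>y' \<in> states \<Sigma>. (y, u, y') \<in> transitions \<Sigma> \<and> (x', y') \<in> r \<and>
      (x' \<in> secret \<Sigma> \<longleftrightarrow> y' \<in> secret \<Sigma>)"
    if xy: "(x, y) \<in> r" and step: "(x, u, x') \<in> transitions \<Sigma>" for x y u x'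
  proof -
    obtain y' where "(y, u, y') \<in> transitions \<Sigma>" "(x', y') \<in> r"
      using matching xy step unfolding transition_matching_def by blast
    then show ?thesis
      using rel_states[of x' y'] secret_iff[of x' y'] by blast
  qed
  show "infsop_bisimulation \<Sigma> \<Sigma> r"
  proof (rule infsop_bisimulationI)
    \<comment> \<open>The back condition is the forth condition for the reversed pair, with the
      resulting pair reversed again.\<close>
    show "\<exists>x' \<in> states \<Sigma>. (x, u, x') \<in> transitions \<Sigma> \<and> (x', y') \<in> r \<and>
        (x' \<in> secret \<Sigma> \<longleftrightarrow> y' \<in> secret \<Sigma>)"
      if "(x, y) \<in> r" "(y, u, y') \<in> transitions \<Sigma>" for x y u y'
      using forth[OF rel_sym[OF that(1)] that(2)] rel_sym by metis
  next
    show "r \<subseteq> states \<Sigma> \<times> states \<Sigma>"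
      using rel_states by auto
  qed (rule refl | erule out_map_eq | erule (1) forth | blast intro: rel_refl init_states)+
qed

text \<open>The quotient relation is the graph of the class map, along which every transition
  projects. The content lies in the back clauses: a transition between classes starts at some
  member, and matching transfers it to any other member.\<close>

lemma infsop_quotient_iff:
  "infsop_bisimulation \<Sigma> quot (quotient_rel \<Sigma> r) \<longleftrightarrow> transition_matching \<Sigma> r"
proof
  assume bisim: "infsop_bisimulation \<Sigma> quot (quotient_rel \<Sigma> r)"
  show "transition_matching \<Sigma> r"
    unfolding transition_matching_def
  proof (intro allI impI)
    fix x y u x'
    assume xy: "(x, y) \<in> r" and step: "(x, u, x') \<in> transitions \<Sigma>"
    have in_states: "x \<in> states \<Sigma>" "y \<in> states \<Sigma>" "u \<in> inputs \<Sigma>" "x' \<in> states \<Sigma>"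
      using rel_states[OF xy] transition_states[OF step] by auto
    \<comment> \<open>The step of \<open>x\<close> is also a step out of \<open>cls y\<close>;
      pulling it back along the pair \<open>(y, cls y)\<close> yields a step of
      \<open>y\<close>.\<close>
    have "cls x = cls y"
      using xy in_states(1) by (simp add: cls_eq_iff)
    then have "(cls y, u, cls x') \<in> transitions quot"
      using step by (auto simp: transitions_quot)
    moreover have "(y, cls y) \<in> quotient_rel \<Sigma> r"
      using in_states by (simp add: quotient_rel_iff)
    moreover have "cls x' \<in> states quot"
      using in_states by (auto simp: states_quot)
    ultimately have "\<exists>y'. (y, u, y') \<in> transitions \<Sigma> \<and> (y', cls x') \<in> quotient_rel \<Sigma> r"
      using infsop_bisimulation_back[OF bisim] in_states(3) by blast
    \<comment> \<open>Membership of \<open>(y', cls x')\<close> in the graph says that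
      \<open>x'\<close> and \<open>y'\<close> have the same class.\<close>
    then show "\<exists>y'. (y, u, y') \<in> transitions \<Sigma> \<and> (x', y') \<in> r"
      using in_states(4) by (auto simp: quotient_rel_iff cls_eq_iff)
  qed
next
  assume matching: "transition_matching \<Sigma> r"
  show "infsop_bisimulation \<Sigma> quot (quotient_rel \<Sigma> r)"
  proof (rule infsop_bisimulationI)
    fix x c u d
    assume "(x, c) \<in> quotient_rel \<Sigma> r" and step: "(c, u, d) \<in> transitions quot"
    then have x: "x \<in> states \<Sigma>" and c: "c = cls x"
      by (simp_all add: quotient_rel_iff)
    \<comment> \<open>The class transition is witnessed at some \<open>z\<close> in the class of
      \<open>x\<close>, possibly not \<open>x\<close>; matching moves the step to \<open>x\<close>
      and keeps the class of its target.\<close>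
    obtain z z' where z: "cls x = cls z" "d = cls z'" "(z, u, z') \<in> transitions \<Sigma>"
      using step by (auto simp: transitions_quot c)
    then have "(z, x) \<in> r"
      using x by (simp add: cls_eq_iff rel_sym)
    then obtain x' where x': "(x, u, x') \<in> transitions \<Sigma>" "(z', x') \<in> r"
      using matching z(3) unfolding transition_matching_def by blast
    then have "x' \<in> states \<Sigma>" "d = cls x'"
      using z(2) rel_states[OF x'(2)] by (simp_all add: cls_eq_iff)
    then show "\<exists>x' \<in> states \<Sigma>. (x, u, x') \<in> transitions \<Sigma> \<and> (x', d) \<in> quotient_rel \<Sigma> r \<and>
        (x' \<in> secret \<Sigma> \<longleftrightarrow> d \<in> secret quot)"
      using x'(1) by (auto simp: cls_in_secret_quot quotient_rel_iff)
  next
    fix x c u x'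
    assume "(x, c) \<in> quotient_rel \<Sigma> r" and step: "(x, u, x') \<in> transitions \<Sigma>"
    \<comment> \<open>The relation is a graph, so \<open>cls x'\<close> is the only candidate for
      the target.\<close>
    then have "(c, u, cls x') \<in> transitions quot"
      by (auto simp: quotient_rel_iff transitions_quot)
    then show "\<exists>d \<in> states quot. (c, u, d) \<in> transitions quot \<and> (x', d) \<in> quotient_rel \<Sigma> r \<and>
        (x' \<in> secret \<Sigma> \<longleftrightarrow> d \<in> secret quot)"
      using transition_states[OF step]
      by (intro bexI[of _ "cls x'"]) (auto simp: quotient_rel_iff states_quot cls_in_secret_quot)
  qed (auto simp: inputs_quot outputs_quot quotient_rel_iff states_quot init_quot
      cls_in_secret_quot out_map_quot init_states)
qed

end

theorem theorem3p22:
  fixes \<Sigma> :: "('x, 'u, 'y) nts" and r :: "('x \<times> 'x) set"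
  assumes "is_nts \<Sigma>"
    and "equiv (states \<Sigma>) r"
    and "\<forall>(x, x') \<in> r. out_map \<Sigma> x = out_map \<Sigma> x'"
    and "\<forall>x \<in> secret \<Sigma>. \<forall>x' \<in> states \<Sigma>. (x, x') \<in> r \<longrightarrow> x' \<in> secret \<Sigma>"
  shows "infsop_bisimulation \<Sigma> (quotient_nts \<Sigma> r) (quotient_rel \<Sigma> r)
     \<longleftrightarrow> infsop_bisimulation \<Sigma> \<Sigma> r"
proof -
  \<comment> \<open>This turns the secrecy hypothesis, stated only for \<open>x'\<close> in
    \<open>states \<Sigma>\<close>, into saturation for all related pairs.\<close>
  have "r \<subseteq> states \<Sigma> \<times> states \<Sigma>"
    using assms(2) by (auto simp: equiv_def)
  then interpret secret_saturated_equiv \<Sigma> r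
    using assms by unfold_locales auto
  show ?thesis
    using infsop_self_iff infsop_quotient_iff by simp
qed

end
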